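(* Consider a MISO system ($p=1$) with horizon $L>l_{\mathrm o}$, where $l_{\mathrm o}$ is its observability index, and historical data $(u_{[1,T]},\hat y_{[1,T]})$ with noise bounded by $\delta$ as described in the context. For $1\le k\le L$ let $\widehat H_k$ be the data matrix built with $l_{\mathrm p}=k$ (see context), and assume $$\delta<\frac{\sigma_{\min}(\widehat H_{l_{\mathrm o}})}{2l_{\mathrm h}}.$$ Then, almost surely, the following algorithm returns $l_{\mathrm o}$: for $k=1,2,3,\dots$ successively, form $\widehat H_k$; at the first $k$ for which $\sigma_{\min}(\widehat H_k)\le l_{\mathrm h}\delta$, stop and return $k-1$.
   Context: Notation: $\sigma_{\min}$ is the smallest singular value; for a sequence $v$, $v_{[a,b]}=\{v_a,\dots,v_b\}$ and $\mathrm{col}(v_{[a,b]})$ is the stacked column vector. System: $x_{t+1}=Ax_t+Bu_t$, $y_t=Cx_t+Du_t$ with $u_t\in\mathbb R^m$, $y_t\in\mathbb R^p$, $x_t\in\mathbb R^{n_x}$, controllable and observable (minimal realization); MISO means $p=1$. The observability index $l_{\mathrm o}$ is the smallest positive integer $l$ such that $[C^\top\ (CA)^\top\ \cdots\ (CA^{l-1})^\top]^\top$ has full column rank. Page matrices: for a sequence $v_{[1,T]}$ and $l_{\mathrm h}=\lfloor T/L\rfloor$, $\mathcal P_L(v_{[1,T]})$ is the matrix with $l_{\mathrm h}$ columns whose $j$-th column is $\mathrm{col}(v_{[(j-1)L+1,\,jL]})$ (and similarly for sequences starting at another index). The sequence $u_{[1,T]}$ is $L$-Page exciting of order $d$ if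 the matrix obtained by stacking vertically $\mathcal P_L(u_{[1,T-(d-1)L]})$, $\mathcal P_L(u_{[L+1,T-(d-2)L]})$, ..., $\mathcal P_L(u_{[L(d-1)+1,T]})$ has full row rank. Historical data: $x_1=0$; the blocks $u_{[1,L]},u_{[L+1,2L]},\dots,u_{[4L^2+1,4L^2+L]}$ are i.i.d. with law $\mathcal Q$ on $\mathbb R^{mL}$, where $\mathcal Q$ gives probability $0$ to every subspace $V\subsetneqq\mathbb R^{mL}$; $T\ge 4L^2+L$ and $u_{[1,T]}$ is $L$-Page exciting of order $n_x+1$. $y_{[1,T]}$ is the resulting noiseless output and $\hat y_{[1,T]}$ the noisy measurement, with every entry of $\mathcal P_L(\hat y_{[1,T]})-\mathcal P_L(y_{[1,T]})$ bounded by $\delta$ in absolute value, $\delta>0$ being a known constant. The matrices $\widehat H_k$: write $U=\mathcal P_L(u_{[1,T]})$, $\widehat Y=\mathcal P_L(\hat y_{[1,T]})$. For $1\le k\le L$ partition $U=[U_{\mathrm p,k}^\top\ U_{\mathrm f,k}^\top]^\top$ with $U_{\mathrm p,k}$ having $km$ rows and $\widehat Y=[\widehat Y_{\mathrm p,k}^\top\ \widehat Y_{\mathrm f,k}^\top]^\top$ with $\widehat Y_{\mathrm p,k}$ having $kp$ rows, and set $\widehat H_k=[U_{\mathrm p,k}^\top\ \widehat Y_{\mathrm p,k}^\top\ U_{\mathrm f,k}^\top]^\top$. *)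

theory Defs
  imports
    "HOL-Probability.Probability"
    "Jordan_Normal_Form.Spectral_Radius"
    "Jordan_Normal_Form.DL_Rank"
begin

unbundle no vec_syntax

section \<open>Matrices\<close>

text \<open>Matrices and vectors are those of \<open>Jordan_Normal_Form\<close>, so that dimensions are ordinary
  naturals.  Rows, columns and components are indexed from 0; time is indexed from 1.\<close>

definition full_row_rank :: "real mat \<Rightarrow> bool" where
  "full_row_rank M \<longleftrightarrow> vec_space.rank (dim_row M) M = dim_row M"

definition full_col_rank :: "real mat \<Rightarrow> bool" where
  "full_col_rank M \<longleftrightarrow> vec_space.rank (dim_row M) M = dim_col M"

text \<open>An \<open>r \<times> c\<close> matrix has \<open>min r c\<close> singular values, the square roots of the eigenvalues of the
  smaller of its two Gram matrices (so that, e.g., a wide matrix has a zero singular value only if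
  it is row rank deficient).  Only the set of values is recorded, without multiplicities.\<close>

definition singular_values :: "real mat \<Rightarrow> real set" where
  "singular_values M =
     sqrt ` spectrum (if dim_row M \<le> dim_col M
                      then M * transpose_mat M else transpose_mat M * M)"

definition sigma_min :: "real mat \<Rightarrow> real" where
  "sigma_min M = Min (singular_values M)"

text \<open>The blocks \<open>F 0, \<dots>, F (d - 1)\<close>, each of size \<open>r \<times> c\<close>, on top of each other.\<close>

definition vstack :: "nat \<Rightarrow> nat \<Rightarrow> nat \<Rightarrow> (nat \<Rightarrow> real mat) \<Rightarrow> real mat" where
  "vstack r c d F = mat (d * r) c (\<lambda>(i, j). F (i div r) $$ (i mod r, j))"

definition hstack :: "nat \<Rightarrow> nat \<Rightarrow> nat \<Rightarrow> (nat \<Rightarrow> real mat) \<Rightarrow> real mat" where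
  "hstack r c d F = mat r (d * c) (\<lambda>(i, j). F (j div c) $$ (i, j mod c))"

definition rows_between :: "nat \<Rightarrow> nat \<Rightarrow> real mat \<Rightarrow> real mat" where
  "rows_between a b M = mat (b - a) (dim_col M) (\<lambda>(i, j). M $$ (a + i, j))"

section \<open>Linear systems\<close>

definition controllability_matrix :: "real mat \<Rightarrow> real mat \<Rightarrow> real mat" where
  "controllability_matrix A B =
     hstack (dim_row A) (dim_col B) (dim_row A) (\<lambda>i. (A ^\<^sub>m i) * B)"

definition observability_matrix :: "real mat \<Rightarrow> real mat \<Rightarrow> nat \<Rightarrow> real mat" where
  "observability_matrix A C l = vstack (dim_row C) (dim_row A) l (\<lambda>i. C * (A ^\<^sub>m i))"

definition controllable :: "real mat \<Rightarrow> real mat \<Rightarrow> bool" where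
  "controllable A B \<longleftrightarrow> full_row_rank (controllability_matrix A B)"

definition observable :: "real mat \<Rightarrow> real mat \<Rightarrow> bool" where
  "observable A C \<longleftrightarrow> full_col_rank (observability_matrix A C (dim_row A))"

definition observability_index :: "real mat \<Rightarrow> real mat \<Rightarrow> nat" where
  "observability_index A C = (LEAST l. 0 < l \<and> full_col_rank (observability_matrix A C l))"

definition trajectory ::
  "real mat \<Rightarrow> real mat \<Rightarrow> real mat \<Rightarrow> real mat \<Rightarrow> nat \<Rightarrow>
   (nat \<Rightarrow> real vec) \<Rightarrow> (nat \<Rightarrow> real vec) \<Rightarrow> (nat \<Rightarrow> real vec) \<Rightarrow> bool" where
  "trajectory A B C D T u x y \<longleftrightarrow>
     (\<forall>t\<in>{1..T}. u t \<in> carrier_vec (dim_col B)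
        \<and> x (Suc t) = A *\<^sub>v x t + B *\<^sub>v u t
        \<and> y t = C *\<^sub>v x t + D *\<^sub>v u t)"

section \<open>Data matrices\<close>

text \<open>\<open>col_seq q v a b\<close> stacks the vectors \<open>v\<^sub>a, \<dots>, v\<^sub>b\<close> of dimension \<open>q\<close>.\<close>

definition col_seq :: "nat \<Rightarrow> (nat \<Rightarrow> real vec) \<Rightarrow> nat \<Rightarrow> nat \<Rightarrow> real vec" where
  "col_seq q v a b = vec ((b + 1 - a) * q) (\<lambda>i. v (a + i div q) $ (i mod q))"

text \<open>The Page matrix with \<open>L\<close> block rows of the sequence \<open>v\<^sub>a, \<dots>, v\<^sub>b\<close> of dimension \<open>q\<close>.  An empty
  sequence (\<open>b < a\<close>) gives a matrix without columns.\<close>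

definition page_matrix :: "nat \<Rightarrow> nat \<Rightarrow> (nat \<Rightarrow> real vec) \<Rightarrow> nat \<Rightarrow> nat \<Rightarrow> real mat" where
  "page_matrix q L v a b =
     mat_of_cols (L * q)
       (map (\<lambda>j. col_seq q v (a + j * L) (a + (j + 1) * L - 1)) [0..<(b + 1 - a) div L])"

definition page_exciting :: "nat \<Rightarrow> nat \<Rightarrow> nat \<Rightarrow> nat \<Rightarrow> (nat \<Rightarrow> real vec) \<Rightarrow> bool" where
  "page_exciting m L T d u \<longleftrightarrow>
     full_row_rank
       (vstack (L * m) ((T - (d - 1) * L) div L) d
          (\<lambda>i. page_matrix m L u (i * L + 1) (T - (d - 1 - i) * L)))"

definition data_matrix ::
  "nat \<Rightarrow> nat \<Rightarrow> nat \<Rightarrow> nat \<Rightarrow> (nat \<Rightarrow> real vec) \<Rightarrow> (nat \<Rightarrow> real vec) \<Rightarrow> nat \<Rightarrow> real mat" where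
  "data_matrix m p L T u y k =
     (let U = page_matrix m L u 1 T; Y = page_matrix p L y 1 T
      in rows_between 0 (k * m) U @\<^sub>r rows_between 0 (k * p) Y @\<^sub>r rows_between (k * m) (L * m) U)"

definition noise_bounded ::
  "nat \<Rightarrow> nat \<Rightarrow> nat \<Rightarrow> real \<Rightarrow> (nat \<Rightarrow> real vec) \<Rightarrow> (nat \<Rightarrow> real vec) \<Rightarrow> bool" where
  "noise_bounded p L T \<delta> y yh \<longleftrightarrow>
     (\<forall>i < L * p. \<forall>j < T div L.
        \<bar>(page_matrix p L yh 1 T - page_matrix p L y 1 T) $$ (i, j)\<bar> \<le> \<delta>)"

text \<open>The loop over \<open>k = 1, 2, \<dots>\<close>, run on the data matrices that exist, i.e.\ those with \<open>k \<le> L\<close>;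
  \<open>None\<close> means that the stopping criterion is never met.\<close>

definition order_search ::
  "nat \<Rightarrow> nat \<Rightarrow> nat \<Rightarrow> nat \<Rightarrow> real \<Rightarrow> (nat \<Rightarrow> real vec) \<Rightarrow> (nat \<Rightarrow> real vec) \<Rightarrow> nat option" where
  "order_search m p L T \<delta> u yh =
     map_option (\<lambda>k. k - 1)
       (find (\<lambda>k. sigma_min (data_matrix m p L T u yh k) \<le> real (T div L) * \<delta>) [1..<L + 1])"

section \<open>Random vectors\<close>

text \<open>The Borel \<open>\<sigma>\<close>-algebra of \<open>\<real>\<^sup>N\<close>, transported to \<open>carrier_vec N\<close> along the coordinates.\<close>

definition borel_vec :: "nat \<Rightarrow> real vec measure" where
  "borel_vec N =
     vimage_algebra (carrier_vec N) (\<lambda>v. \<lambda>i\<in>{..<N}. v $ i) (Pi\<^sub>M {..<N} (\<lambda>_. borel))"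

definition null_on_proper_subspaces :: "nat \<Rightarrow> real vec measure \<Rightarrow> bool" where
  "null_on_proper_subspaces N Q \<longleftrightarrow>
     (\<forall>V. VectorSpace.subspace class_ring V (module_vec TYPE(real) N) \<and> V \<noteq> carrier_vec N
        \<longrightarrow> emeasure Q V = 0)"

end

theory Submission
  imports Defs
begin

text \<open>The argument is pathwise: it is carried out for a fixed outcome.  Write \<open>l = T div L\<close>.  With one output,
each further block row of the observability matrix adds at most one to the rank, so the observability
index is the state dimension \<open>n\<close> (\<open>observability_index_single_output\<close>), and it has to be
shown that the threshold \<open>l * \<delta>\<close> is first met at \<open>k = n + 1\<close>.

For \<open>k \<le> n\<close>, the matrix for \<open>k\<close> consists of rows of the matrix for \<open>n\<close>, in another order.  Both are
wide, and the least singular value of a wide matrix is the minimum of the norm of a row combination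
with unit coefficient vector (\<open>sigma_min_wide\<close>), which can only grow when rows are removed.  So the
assumed lower bound at \<open>n\<close> carries over to all smaller \<open>k\<close>.

For \<open>k = n + 1\<close>, consecutive outputs \<open>y\<^sub>t, \<dots>, y\<^bsub>t+n\<^esub>\<close> depend on the state \<open>x\<^sub>t\<close> through \<open>n + 1\<close> row
vectors of length \<open>n\<close>.  A linear dependence between these eliminates the state and expresses a
nontrivial combination of the outputs by the inputs, with coefficients that do not depend on \<open>t\<close>
(\<open>outputs_dependent_modulo_inputs\<close>).  This annihilates the rows of the noiseless data
matrix.  Applied to the noisy one it leaves a combination of \<open>n + 1 \<le> l\<close> rows of noise, whose norm is at
most \<open>l * \<delta>\<close> times that of the coefficients by Cauchy-Schwarz (\<open>sigma_min_data_matrix_le\<close>).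

That the data matrices are wide follows from Page excitation, whose full row rank needs at least
\<open>(n + 1) * L * m\<close> columns (\<open>page_exciting_wide\<close>).\<close>

unbundle no inner_syntax

section \<open>The least singular value as a minimum\<close>

text \<open>The Rayleigh principle: a quadratic form attains its minimum on the unit sphere, and the first-order
condition there is the eigenvector equation.  Vectors are functions on the naturals, which makes
the sphere a subset of a product of compact intervals; the coordinates from \<open>N\<close> on are pinned to \<open>0\<close>,
since otherwise the sphere would not be compact.\<close>

lemma quadratic_form_min_eigenpair:
  fixes g :: "nat \<Rightarrow> nat \<Rightarrow> real"
  assumes sym: "\<And>i j. g i j = g j i" and N: "0 < N"
  shows "\<exists>f \<mu>. (\<exists>i<N. f i \<noteq> 0) \<and> (\<forall>i<N. (\<Sum>j<N. g i j * f j) = \<mu> * f i)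
    \<and> (\<forall>h. \<mu> * (\<Sum>i<N. (h i)\<^sup>2) \<le> (\<Sum>i<N. \<Sum>j<N. h i * g i j * h j))"
proof -
  define q where "q = (\<lambda>h. \<Sum>i<N. \<Sum>j<N. h i * g i j * h j)"
  define s where "s = (\<lambda>h::nat \<Rightarrow> real. \<Sum>i<N. (h i)\<^sup>2)"
  define K where "K = (\<Pi>\<^sub>E i\<in>UNIV. if i < N then {-1..1::real} else {0})"
  define S where "S = K \<inter> {h. s h = 1}"
  have "compactin (product_topology (\<lambda>_. euclidean) UNIV) K"
    unfolding K_def by (subst compactin_PiE) auto
  then have "compact K"
    by (simp add: euclidean_product_topology)
  moreover have "closed {h. s h = 1}"
    unfolding s_def by (intro closed_Collect_eq continuous_intros) auto
  ultimately have "compact S"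
    unfolding S_def by (rule compact_Int_closed)
  moreover have "(\<lambda>i. if i = 0 then 1 else 0) \<in> S"
    using N by (auto simp: S_def K_def s_def if_distrib[of "\<lambda>x. x\<^sup>2"] cong: if_cong)
  then have "S \<noteq> {}" by blast
  moreover have "continuous_on S q"
    unfolding q_def
    by (intro continuous_intros continuous_on_subset[OF continuous_on_product_coordinates]) auto
  ultimately obtain f where f: "f \<in> S" and fmin: "\<And>h. h \<in> S \<Longrightarrow> q f \<le> q h"
    using continuous_attains_inf by metis
  have sf: "s f = 1" using f by (simp add: S_def)
  have s0: "s h = 0 \<longleftrightarrow> (\<forall>i<N. h i = 0)" for h
    unfolding s_def by (subst sum_nonneg_eq_0_iff) auto
  have s_nonneg: "0 \<le> s h" for h
    unfolding s_def by (simp add: sum_nonneg)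
  have bound: "q f * s h \<le> q h" for h
  proof (cases "s h = 0")
    case True
    then have "q h = 0" by (simp add: s0 q_def)
    with True show ?thesis by simp
  next
    case False
    then have pos: "0 < s h" using s_nonneg[of h] by simp
    define h' where "h' = (\<lambda>i. if i < N then h i / sqrt (s h) else 0)"
    have "s h' = (\<Sum>i<N. (h' i)\<^sup>2)"
      by (simp add: s_def)
    also have "\<dots> = (\<Sum>i<N. (h i)\<^sup>2 / s h)"
      using pos by (intro sum.cong) (auto simp: h'_def power_divide)
    also have "\<dots> = 1"
      using pos by (simp add: sum_divide_distrib[symmetric] s_def)
    finally have s1: "s h' = 1" .
    have "\<bar>h' i\<bar> \<le> 1" if "i < N" for i
    proof -
      have "(h' i)\<^sup>2 \<le> s h'"
        unfolding s_def using that by (intro member_le_sum) auto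
      then show ?thesis using s1 by (simp add: abs_square_le_1)
    qed
    then have "h' \<in> S"
      using s1 by (auto simp: S_def K_def PiE_iff abs_le_iff) (auto simp: h'_def)
    then have "q f \<le> q h'" by (rule fmin)
    also have "q h' = (\<Sum>i<N. \<Sum>j<N. (h i * g i j * h j) / s h)"
      unfolding q_def using pos
      by (intro sum.cong) (auto simp: h'_def real_sqrt_mult[symmetric] field_simps)
    also have "\<dots> = q h / s h"
      by (simp add: sum_divide_distrib[symmetric] q_def)
    finally show ?thesis using pos by (simp add: field_simps)
  qed
  \<comment> \<open>The residual of the eigenvector equation, half the gradient of \<open>h \<mapsto> q h - q f * s h\<close> at \<open>f\<close>.
    If it did not vanish, a small step against it would push this nonnegative function below \<open>0\<close>.\<close>
  define e where "e = (\<lambda>i. (\<Sum>j<N. g i j * f j) - q f * f i)"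
  have expand: "q (\<lambda>i. f i + t * e i) - q f * s (\<lambda>i. f i + t * e i)
      = 2 * t * s e + t\<^sup>2 * (q e - q f * s e)" for t
  proof -
    define b where "b = (\<Sum>i<N. \<Sum>j<N. e i * g i j * f j)"
    have b': "(\<Sum>i<N. \<Sum>j<N. f i * g i j * e j) = b"
      unfolding b_def by (subst sum.swap) (simp add: sym mult_ac)
    have "q (\<lambda>i. f i + t * e i) = (\<Sum>i<N. \<Sum>j<N. f i * g i j * f j
        + (t * (e i * g i j * f j) + (t * (f i * g i j * e j) + t\<^sup>2 * (e i * g i j * e j))))"
      unfolding q_def by (intro sum.cong) (auto simp: algebra_simps power2_eq_square)
    also have "\<dots> = q f + (t * b + (t * b + t\<^sup>2 * q e))"
      unfolding b'[symmetric] by (simp add: sum.distrib sum_distrib_left[symmetric] q_def b' b_def)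
    finally have 1: "q (\<lambda>i. f i + t * e i) = q f + 2 * t * b + t\<^sup>2 * q e" by simp
    have "s (\<lambda>i. f i + t * e i) = (\<Sum>i<N. (f i)\<^sup>2 + (2 * t * (e i * f i) + t\<^sup>2 * (e i)\<^sup>2))"
      unfolding s_def by (intro sum.cong) (auto simp: algebra_simps power2_eq_square)
    also have "\<dots> = s f + (2 * t * (\<Sum>i<N. e i * f i) + t\<^sup>2 * s e)"
      by (simp add: sum.distrib sum_distrib_left[symmetric] s_def)
    finally have 2: "s (\<lambda>i. f i + t * e i) = s f + (2 * t * (\<Sum>i<N. e i * f i) + t\<^sup>2 * s e)" .
    have "s e = (\<Sum>i<N. e i * ((\<Sum>j<N. g i j * f j) - q f * f i))"
      unfolding s_def by (simp add: e_def power2_eq_square)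
    also have "\<dots> = b - q f * (\<Sum>i<N. e i * f i)"
      by (simp add: b_def right_diff_distrib sum_subtractf sum_distrib_left mult_ac)
    finally have 3: "b = s e + q f * (\<Sum>i<N. e i * f i)" by simp
    show ?thesis unfolding 1 2 3 sf by (simp add: algebra_simps)
  qed
  have "s e = 0"
  proof (rule ccontr)
    assume "s e \<noteq> 0"
    then have pos: "0 < s e" using s_nonneg[of e] by simp
    define p where "p = q e - q f * s e"
    have "0 \<le> p" using bound[of e] by (simp add: p_def)
    have nonneg: "0 \<le> 2 * t * s e + t\<^sup>2 * p" for t
      using bound[of "\<lambda>i. f i + t * e i"] expand[of t] by (simp add: p_def)
    \<comment> \<open>A parabola with slope \<open>2 * s e\<close> at its root \<open>0\<close> is negative shortly before.  The step \<open>r\<close> is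
      taken with \<open>p + 1\<close> because \<open>p\<close> may vanish.\<close>
    define r where "r = s e / (p + 1)"
    have se: "s e = r * (p + 1)" and "0 < r"
      using pos \<open>0 \<le> p\<close> by (simp_all add: r_def)
    have "0 \<le> 2 * (- r) * s e + (- r)\<^sup>2 * p"
      by (rule nonneg)
    also have "\<dots> = - (r\<^sup>2 * (p + 2))"
      by (simp add: se algebra_simps power2_eq_square)
    also have "\<dots> < 0"
      using \<open>0 < r\<close> \<open>0 \<le> p\<close> by simp
    finally show False by simp
  qed
  then have "(\<Sum>j<N. g i j * f j) = q f * f i" if "i < N" for i
    using that by (simp add: s0 e_def)
  moreover have "\<exists>i<N. f i \<noteq> 0"
    using sf s0[of f] by auto
  ultimately show ?thesis
    using bound by (intro exI[of _ f] exI[of _ "q f"]) (simp add: q_def s_def)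
qed

lemma sum_squares_pos:
  fixes f :: "nat \<Rightarrow> real"
  assumes "\<exists>i<r. f i \<noteq> 0"
  shows "0 < (\<Sum>i<r. (f i)\<^sup>2)"
proof -
  obtain i where "i < r" "f i \<noteq> 0" using assms by blast
  then show ?thesis by (intro sum_pos2[of _ i]) auto
qed

lemma eigenvalue_iff_sums:
  fixes G :: "real mat"
  assumes "G \<in> carrier_mat N N"
  shows "eigenvalue G \<mu> \<longleftrightarrow>
    (\<exists>f. (\<exists>i<N. f i \<noteq> 0) \<and> (\<forall>i<N. (\<Sum>j<N. G $$ (i, j) * f j) = \<mu> * f i))"
proof
  assume "eigenvalue G \<mu>"
  then obtain v where v: "v \<in> carrier_vec N" "v \<noteq> 0\<^sub>v N" "G *\<^sub>v v = \<mu> \<cdot>\<^sub>v v"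
    using assms by (auto simp: eigenvalue_def eigenvector_def)
  have "\<exists>i<N. v $ i \<noteq> 0"
    using v(1,2) by (metis carrier_vecD eq_vecI index_zero_vec(1) index_zero_vec(2))
  moreover have "(\<Sum>j<N. G $$ (i, j) * v $ j) = \<mu> * v $ i" if "i < N" for i
    using arg_cong[OF v(3), of "\<lambda>w. w $ i"] that v(1) assms
    by (auto simp: scalar_prod_def lessThan_atLeast0)
  ultimately show "\<exists>f. (\<exists>i<N. f i \<noteq> 0) \<and> (\<forall>i<N. (\<Sum>j<N. G $$ (i, j) * f j) = \<mu> * f i)"
    by blast
next
  assume "\<exists>f. (\<exists>i<N. f i \<noteq> 0) \<and> (\<forall>i<N. (\<Sum>j<N. G $$ (i, j) * f j) = \<mu> * f i)"
  then obtain f where f: "\<exists>i<N. f i \<noteq> 0" "\<And>i. i < N \<Longrightarrow> (\<Sum>j<N. G $$ (i, j) * f j) = \<mu> * f i"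
    by blast
  have "vec N f \<noteq> 0\<^sub>v N" using f(1) by (metis index_vec index_zero_vec(1))
  moreover have "G *\<^sub>v vec N f = \<mu> \<cdot>\<^sub>v vec N f"
    using assms f(2) by (intro eq_vecI) (auto simp: scalar_prod_def lessThan_atLeast0)
  ultimately show "eigenvalue G \<mu>"
    using assms unfolding eigenvalue_def eigenvector_def by (intro exI[of _ "vec N f"]) auto
qed

text \<open>The squared norm \<open>\<parallel>w\<^sup>T M\<parallel>\<^sup>2\<close>, with coefficient functions in place of vectors, so that row combinations
of different matrices can be compared without conversions between vector dimensions.\<close>

definition row_comb_sq :: "real mat \<Rightarrow> (nat \<Rightarrow> real) \<Rightarrow> real" where
  "row_comb_sq M w = (\<Sum>j<dim_col M. (\<Sum>i<dim_row M. w i * M $$ (i, j))\<^sup>2)"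

lemma gram_quadratic_form:
  assumes "M \<in> carrier_mat r c"
  shows "(\<Sum>i<r. \<Sum>k<r. w i * (\<Sum>j<c. M $$ (i, j) * M $$ (k, j)) * w k) = row_comb_sq M w"
proof -
  have "row_comb_sq M w = (\<Sum>j<c. \<Sum>i<r. \<Sum>k<r. (w i * M $$ (i, j)) * (w k * M $$ (k, j)))"
    using assms by (simp add: row_comb_sq_def power2_eq_square sum_product)
  also have "\<dots> = (\<Sum>i<r. \<Sum>j<c. \<Sum>k<r. (w i * M $$ (i, j)) * (w k * M $$ (k, j)))"
    by (rule sum.swap)
  also have "\<dots> = (\<Sum>i<r. \<Sum>k<r. \<Sum>j<c. (w i * M $$ (i, j)) * (w k * M $$ (k, j)))"
    by (intro sum.cong refl sum.swap)
  also have "\<dots> = (\<Sum>i<r. \<Sum>k<r. w i * (\<Sum>j<c. M $$ (i, j) * M $$ (k, j)) * w k)"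
    by (simp add: sum_distrib_left sum_distrib_right mult_ac)
  finally show ?thesis by simp
qed

text \<open>For a wide matrix the Gram matrix is \<open>M M\<^sup>T\<close>, whose quadratic form is \<open>row_comb_sq M\<close>.  The minimal
eigenpair also shows that the spectrum over the reals is nonempty, without which the minimum in
\<open>sigma_min\<close> would be unspecified.\<close>

lemma sigma_min_wide:
  assumes M: "M \<in> carrier_mat r c" and r: "0 < r" "r \<le> c"
  shows sigma_min_nonneg: "0 \<le> sigma_min M"
    and sigma_min_le: "(sigma_min M)\<^sup>2 * (\<Sum>i<r. (w i)\<^sup>2) \<le> row_comb_sq M w"
    and sigma_min_attained:
      "\<exists>v. (\<exists>i<r. v i \<noteq> 0) \<and> row_comb_sq M v = (sigma_min M)\<^sup>2 * (\<Sum>i<r. (v i)\<^sup>2)"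
proof -
  define G where "G = M * transpose_mat M"
  define g where "g = (\<lambda>i k. \<Sum>j<c. M $$ (i, j) * M $$ (k, j))"
  have G: "G \<in> carrier_mat r r" using M by (simp add: G_def)
  have Gg: "G $$ (i, k) = g i k" if "i < r" "k < r" for i k
    using M that by (simp add: G_def g_def scalar_prod_def lessThan_atLeast0)
  have sym: "g i k = g k i" for i k by (simp add: g_def mult.commute)
  have form: "(\<Sum>i<r. \<Sum>k<r. w i * g i k * w k) = row_comb_sq M w" for w
    unfolding g_def by (rule gram_quadratic_form[OF M])
  have eig: "row_comb_sq M f = \<mu> * (\<Sum>i<r. (f i)\<^sup>2)"
    if "\<And>i. i < r \<Longrightarrow> (\<Sum>k<r. g i k * f k) = \<mu> * f i" for f \<mu>
  proof -
    have "row_comb_sq M f = (\<Sum>i<r. f i * (\<Sum>k<r. g i k * f k))"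
      unfolding form[symmetric] by (simp add: sum_distrib_left mult_ac)
    also have "\<dots> = (\<Sum>i<r. f i * (\<mu> * f i))"
      using that by (intro sum.cong) auto
    finally show ?thesis by (simp add: sum_distrib_left power2_eq_square mult_ac)
  qed
  have pos: "0 < (\<Sum>i<r. (f i)\<^sup>2)" if "\<exists>i<r. f i \<noteq> 0" for f :: "nat \<Rightarrow> real"
    using that by (rule sum_squares_pos)
  obtain f \<mu> where f: "\<exists>i<r. f i \<noteq> 0" "\<And>i. i < r \<Longrightarrow> (\<Sum>j<r. g i j * f j) = \<mu> * f i"
    and min: "\<And>h. \<mu> * (\<Sum>i<r. (h i)\<^sup>2) \<le> (\<Sum>i<r. \<Sum>j<r. h i * g i j * h j)"
    using quadratic_form_min_eigenpair[of g r, OF sym r(1)] by blast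
  have "row_comb_sq M f \<ge> 0" by (simp add: row_comb_sq_def sum_nonneg)
  with eig[OF f(2)] pos[OF f(1)] have "0 \<le> \<mu>" by (simp add: zero_le_mult_iff)
  have eigval: "eigenvalue G \<nu> \<longleftrightarrow>
      (\<exists>f. (\<exists>i<r. f i \<noteq> 0) \<and> (\<forall>i<r. (\<Sum>j<r. g i j * f j) = \<nu> * f i))" for \<nu>
  proof -
    have "(\<Sum>j<r. G $$ (i, j) * f j) = (\<Sum>j<r. g i j * f j)" if "i < r" for f i
      using Gg that by (intro sum.cong) auto
    then show ?thesis
      unfolding eigenvalue_iff_sums[OF G] by simp
  qed
  have "\<mu> \<in> spectrum G" unfolding spectrum_def mem_Collect_eq eigval
    using f by (intro exI[of _ f]) simp
  moreover have "\<mu> \<le> \<nu>" if \<nu>: "\<nu> \<in> spectrum G" for \<nu>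
  proof -
    obtain h where h: "\<exists>i<r. h i \<noteq> 0" "\<And>i. i < r \<Longrightarrow> (\<Sum>j<r. g i j * h j) = \<nu> * h i"
      using \<nu> unfolding spectrum_def mem_Collect_eq eigval by blast
    have "\<mu> * (\<Sum>i<r. (h i)\<^sup>2) \<le> \<nu> * (\<Sum>i<r. (h i)\<^sup>2)"
      using min[of h] eig[of h \<nu>] h(2) unfolding form by simp
    then show ?thesis using pos[OF h(1)] by simp
  qed
  ultimately have "Min (sqrt ` spectrum G) = sqrt \<mu>"
    using card_finite_spectrum(1)[OF G] by (intro Min_eqI) auto
  then have \<sigma>: "sigma_min M = sqrt \<mu>"
    using M r by (simp add: sigma_min_def singular_values_def G_def)
  show "0 \<le> sigma_min M" using \<open>0 \<le> \<mu>\<close> by (simp add: \<sigma>)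
  show "(sigma_min M)\<^sup>2 * (\<Sum>i<r. (w i)\<^sup>2) \<le> row_comb_sq M w"
    using min[of w] \<open>0 \<le> \<mu>\<close> unfolding \<sigma> form by simp
  show "\<exists>v. (\<exists>i<r. v i \<noteq> 0) \<and> row_comb_sq M v = (sigma_min M)\<^sup>2 * (\<Sum>i<r. (v i)\<^sup>2)"
    using f(1) eig[OF f(2)] \<open>0 \<le> \<mu>\<close> unfolding \<sigma> by (intro exI[of _ f]) simp
qed

text \<open>A row combination of \<open>M'\<close> is one of \<open>M\<close> with zero coefficients at the remaining rows, so the minimum
for \<open>M\<close> runs over more candidates.\<close>

lemma sigma_min_mono_row_selection:
  assumes M: "M \<in> carrier_mat r c" and M': "M' \<in> carrier_mat r' c"
    and "0 < r'" "r \<le> c"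
    and inj: "inj_on s {..<r'}" and sub: "s ` {..<r'} \<subseteq> {..<r}"
    and rows: "\<And>i j. i < r' \<Longrightarrow> j < c \<Longrightarrow> M' $$ (i, j) = M $$ (s i, j)"
  shows "sigma_min M \<le> sigma_min M'"
proof -
  have "r' \<le> r" using card_inj_on_le[OF inj sub] by simp
  then have r: "0 < r" "r' \<le> c" using assms by auto
  obtain v where v: "\<exists>i<r'. v i \<noteq> 0"
    and v': "row_comb_sq M' v = (sigma_min M')\<^sup>2 * (\<Sum>i<r'. (v i)\<^sup>2)"
    using sigma_min_attained[OF M' \<open>0 < r'\<close> r(2)] by blast
  define w where "w = (\<lambda>i. if i \<in> s ` {..<r'} then v (inv_into {..<r'} s i) else 0)"
  have w: "(\<Sum>i<r. F (w i) i) = (\<Sum>i<r'. F (v i) (s i))" if "\<And>i. F 0 i = 0"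
    for F :: "real \<Rightarrow> nat \<Rightarrow> real"
  proof -
    have "(\<Sum>i<r. F (w i) i) = (\<Sum>i\<in>s ` {..<r'}. F (w i) i)"
      using sub that by (intro sum.mono_neutral_right) (auto simp: w_def)
    also have "\<dots> = (\<Sum>i<r'. F (w (s i)) (s i))"
      by (simp add: sum.reindex[OF inj])
    also have "\<dots> = (\<Sum>i<r'. F (v i) (s i))"
      using inj by (intro sum.cong) (auto simp: w_def)
    finally show ?thesis .
  qed
  have "row_comb_sq M w = row_comb_sq M' v"
    using M M' w[of "\<lambda>x i. x * M $$ (i, _)"] rows
    by (auto simp: row_comb_sq_def intro!: sum.cong arg_cong[of _ _ "\<lambda>x. x\<^sup>2"])
  moreover have "(\<Sum>i<r. (w i)\<^sup>2) = (\<Sum>i<r'. (v i)\<^sup>2)"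
    using w[of "\<lambda>x i. x\<^sup>2"] by simp
  ultimately have "(sigma_min M)\<^sup>2 * (\<Sum>i<r'. (v i)\<^sup>2) \<le> (sigma_min M')\<^sup>2 * (\<Sum>i<r'. (v i)\<^sup>2)"
    using sigma_min_le[OF M r(1) \<open>r \<le> c\<close>, of w] v' by simp
  moreover have "0 < (\<Sum>i<r'. (v i)\<^sup>2)"
    using v by (rule sum_squares_pos)
  ultimately have "(sigma_min M)\<^sup>2 \<le> (sigma_min M')\<^sup>2" by simp
  then show ?thesis
    using sigma_min_nonneg[OF M' \<open>0 < r'\<close> r(2)] by (rule power2_le_imp_le)
qed

lemma sigma_min_le_of_small_row_combination:
  assumes M: "M \<in> carrier_mat r c" and r: "0 < r" "r \<le> c"
    and v: "\<exists>i<r. v i \<noteq> 0"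
    and small: "\<And>j. j < c \<Longrightarrow> (\<Sum>i<r. v i * M $$ (i, j))\<^sup>2 \<le> b * (\<Sum>i<r. (v i)\<^sup>2)"
    and \<tau>: "real c * b \<le> \<tau>\<^sup>2" "0 \<le> \<tau>"
  shows "sigma_min M \<le> \<tau>"
proof -
  have pos: "0 < (\<Sum>i<r. (v i)\<^sup>2)" using v by (rule sum_squares_pos)
  have "(sigma_min M)\<^sup>2 * (\<Sum>i<r. (v i)\<^sup>2) \<le> row_comb_sq M v"
    by (rule sigma_min_le[OF M r])
  also have "\<dots> \<le> (\<Sum>j<c. b * (\<Sum>i<r. (v i)\<^sup>2))"
    unfolding row_comb_sq_def carrier_matD[OF M] using small by (intro sum_mono) simp
  also have "\<dots> = (real c * b) * (\<Sum>i<r. (v i)\<^sup>2)" by simp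
  also have "\<dots> \<le> \<tau>\<^sup>2 * (\<Sum>i<r. (v i)\<^sup>2)"
    using \<tau>(1) pos by (intro mult_right_mono) auto
  finally have "(sigma_min M)\<^sup>2 \<le> \<tau>\<^sup>2" using pos by simp
  then show ?thesis using \<tau>(2) by (rule power2_le_imp_le)
qed

section \<open>Data matrices of single-output data\<close>

lemma page_matrix_carrier: "page_matrix q L v 1 T \<in> carrier_mat (L * q) (T div L)"
  by (auto simp: page_matrix_def)

lemma page_matrix_index:
  assumes "i < L * q" "j < T div L"
  shows "page_matrix q L v 1 T $$ (i, j) = v (1 + j * L + i div q) $ (i mod q)"
  using assms by (simp add: page_matrix_def mat_of_cols_index col_seq_def)

lemma data_matrix_carrier:
  assumes "k \<le> L"
  shows "data_matrix m 1 L T u y k \<in> carrier_mat (L * m + k) (T div L)"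
proof -
  obtain q where q: "L * m = k * m + q"
    using mult_le_mono1[OF assms] le_Suc_ex by blast
  moreover have "dim_col (page_matrix m L u 1 T) = T div L"
    using page_matrix_carrier by blast
  ultimately show ?thesis
    unfolding data_matrix_def Let_def rows_between_def append_rows_def
    by (intro carrier_matI) simp_all
qed

lemma data_matrix_index:
  assumes "k \<le> L" "r < L * m + k" "j < T div L"
  shows "data_matrix m 1 L T u y k $$ (r, j) =
    (if r < k * m then page_matrix m L u 1 T $$ (r, j)
     else if r < k * m + k then page_matrix 1 L y 1 T $$ (r - k * m, j)
     else page_matrix m L u 1 T $$ (r - k, j))"
proof -
  define U Y where "U = page_matrix m L u 1 T" and "Y = page_matrix 1 L y 1 T"
  have dims: "dim_col U = T div L" "dim_col Y = T div L"
    unfolding U_def Y_def using page_matrix_carrier by blast+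
  obtain a q where a: "k * m = a" and q: "L * m = a + q"
    using mult_le_mono1[OF assms(1)] le_Suc_ex by blast
  have "r - a < k \<longleftrightarrow> r < a + k" if "\<not> r < a" using that by auto
  then show ?thesis
    using assms(2,3) dims
    unfolding data_matrix_def Let_def rows_between_def append_rows_def U_def[symmetric] Y_def[symmetric] a q
    by (auto simp: add.commute)
qed

text \<open>Both matrices contain all input rows, and the matrix for \<open>k\<close> only the first \<open>k\<close> of the \<open>n\<close> output rows.\<close>

lemma sigma_min_data_matrix_antimono:
  assumes "k \<le> n" "n \<le> L" "0 < L * m + k" "L * m + n \<le> T div L"
  shows "sigma_min (data_matrix m 1 L T u y n) \<le> sigma_min (data_matrix m 1 L T u y k)"
proof (rule sigma_min_mono_row_selection[OF data_matrix_carrier data_matrix_carrier])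
  \<comment> \<open>Input rows up to \<open>k * m\<close> stay in place, output rows move behind \<open>n * m\<close> input rows, and the
    remaining input rows lie above or below the output block of the larger matrix.\<close>
  define a where "a = k * m"
  define b where "b = n * m"
  have ab: "a \<le> b" "b \<le> L * m"
    unfolding a_def b_def using assms by (auto intro: mult_le_mono1)
  define s where "s = (\<lambda>r. if r < a then r else if r < a + k then b + (r - a)
    else if r - k < b then r - k else (r - k) + n)"
  show "inj_on s {..<L * m + k}"
    unfolding inj_on_def s_def using ab \<open>k \<le> n\<close> by (auto split: if_splits)
  have s: "s r < L * m + n" if "r < L * m + k" for r
    unfolding s_def using that ab \<open>k \<le> n\<close> by auto
  then show "s ` {..<L * m + k} \<subseteq> {..<L * m + n}"
    by auto
  show "data_matrix m 1 L T u y k $$ (r, j) = data_matrix m 1 L T u y n $$ (s r, j)"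
    if r: "r < L * m + k" and j: "j < T div L" for r j
  proof -
    have "k \<le> L" using assms by simp
    show ?thesis
      unfolding data_matrix_index[OF \<open>k \<le> L\<close> r j] data_matrix_index[OF \<open>n \<le> L\<close> s[OF r] j]
        a_def[symmetric] b_def[symmetric]
      unfolding s_def using ab \<open>k \<le> n\<close> by auto
  qed
qed (use assms in auto)

lemma sum_lessThan_add:
  fixes F :: "nat \<Rightarrow> 'a::comm_monoid_add"
  shows "(\<Sum>i<a + b. F i) = (\<Sum>i<a. F i) + (\<Sum>i<b. F (a + i))"
  by (induction b) (auto simp: add.assoc)

text \<open>The relation \<open>rel\<close> between the noiseless outputs and the inputs, read as a row combination of the noisy
data matrix, cancels everything but the noise.  Cauchy-Schwarz bounds each of the \<open>T div L\<close> entries of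
the result by \<open>sqrt k * \<delta>\<close> times the norm of the coefficients, and \<open>k \<le> T div L\<close>.\<close>

lemma sigma_min_data_matrix_le:
  assumes kL: "k \<le> L" and wide: "L * m + k \<le> T div L"
    and noise: "noise_bounded 1 L T \<delta> y yh"
    and c: "\<exists>i<k. c i \<noteq> 0"
    and rel: "\<And>j. j < T div L \<Longrightarrow>
      (\<Sum>i<k. c i * page_matrix 1 L y 1 T $$ (i, j))
        = (\<Sum>r<k * m. w r * page_matrix m L u 1 T $$ (r, j))"
    and "0 \<le> \<delta>"
  shows "sigma_min (data_matrix m 1 L T u yh k) \<le> real (T div L) * \<delta>"
proof -
  define v where "v = (\<lambda>r. if r < k * m then - w r else if r < k * m + k then c (r - k * m) else 0)"
  define Y Yh U where "Y = page_matrix 1 L y 1 T" and "Yh = page_matrix 1 L yh 1 T"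
    and "U = page_matrix m L u 1 T"
  have "k * m \<le> L * m" using kL by (rule mult_le_mono1)
  then obtain q where q: "L * m = k * m + q" using le_Suc_ex by blast
  have split: "(\<Sum>r<L * m + k. F r)
      = (\<Sum>r<k * m. F r) + (\<Sum>i<k. F (k * m + i)) + (\<Sum>i<q. F (k * m + k + i))"
    for F :: "nat \<Rightarrow> real"
  proof -
    have "L * m + k = k * m + k + q" using q by simp
    then show ?thesis by (simp only: sum_lessThan_add)
  qed
  from c obtain i where "i < k" "c i \<noteq> 0" by blast
  then have v0: "\<exists>r<L * m + k. v r \<noteq> 0"
    by (intro exI[of _ "k * m + i"]) (auto simp: v_def q)
  have cv: "(\<Sum>i<k. (c i)\<^sup>2) \<le> (\<Sum>r<L * m + k. (v r)\<^sup>2)"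
    by (subst split) (simp add: v_def sum_nonneg)
  show ?thesis
  proof (rule sigma_min_le_of_small_row_combination[OF data_matrix_carrier[OF kL] _ wide v0])
    show "0 < L * m + k" using \<open>i < k\<close> by simp
    fix j assume j: "j < T div L"
    have "(\<Sum>r<L * m + k. v r * data_matrix m 1 L T u yh k $$ (r, j))
        = (\<Sum>r<k * m. - w r * U $$ (r, j)) + (\<Sum>i<k. c i * Yh $$ (i, j))"
      using j kL
      by (subst split) (simp add: v_def q U_def Yh_def data_matrix_index[unfolded One_nat_def])
    also have "\<dots> = (\<Sum>i<k. c i * (Yh $$ (i, j) - Y $$ (i, j)))"
      using rel[OF j] by (simp add: U_def Y_def sum_negf right_diff_distrib sum_subtractf)
    finally have eq: "(\<Sum>r<L * m + k. v r * data_matrix m 1 L T u yh k $$ (r, j))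
        = (\<Sum>i<k. c i * (Yh $$ (i, j) - Y $$ (i, j)))" .
    have "(\<Sum>i<k. c i * (Yh $$ (i, j) - Y $$ (i, j)))\<^sup>2
        \<le> (\<Sum>i<k. (c i)\<^sup>2) * (\<Sum>i<k. (Yh $$ (i, j) - Y $$ (i, j))\<^sup>2)"
      by (rule Cauchy_Schwarz_ineq_sum)
    also have "\<dots> \<le> (\<Sum>r<L * m + k. (v r)\<^sup>2) * (\<Sum>i<k. \<delta>\<^sup>2)"
    proof (intro mult_mono cv sum_mono)
      fix i assume "i \<in> {..<k}"
      then have "i < L" using kL by simp
      then have "\<bar>Yh $$ (i, j) - Y $$ (i, j)\<bar> \<le> \<delta>"
        using noise j page_matrix_carrier[of 1 L y T] page_matrix_carrier[of 1 L yh T]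
        by (auto simp: noise_bounded_def Y_def Yh_def)
      then show "(Yh $$ (i, j) - Y $$ (i, j))\<^sup>2 \<le> \<delta>\<^sup>2"
        by (rule abs_le_square_iff[THEN iffD1, OF order_trans]) simp
    qed (auto intro: sum_nonneg)
    finally show "(\<Sum>r<L * m + k. v r * data_matrix m 1 L T u yh k $$ (r, j))\<^sup>2
        \<le> (real k * \<delta>\<^sup>2) * (\<Sum>r<L * m + k. (v r)\<^sup>2)"
      unfolding eq by (simp add: mult.commute)
  next
    have "real (T div L) * (real k * \<delta>\<^sup>2) \<le> real (T div L) * (real (T div L) * \<delta>\<^sup>2)"
      using wide by (intro mult_left_mono mult_right_mono) auto
    then show "real (T div L) * (real k * \<delta>\<^sup>2) \<le> (real (T div L) * \<delta>)\<^sup>2"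
      by (simp add: power2_eq_square mult_ac)
    show "0 \<le> real (T div L) * \<delta>" using \<open>0 \<le> \<delta>\<close> by simp
  qed
qed

section \<open>Rank and dimensions\<close>

lemma full_row_rank_dims: "full_row_rank M \<Longrightarrow> dim_row M \<le> dim_col M"
  unfolding full_row_rank_def
  by (metis carrier_matI vec_space.rank_le_nc)

lemma (in vec_space) rank_le_nr:
  assumes "A \<in> carrier_mat n nc"
  shows "rank A \<le> n"
proof -
  obtain S where S: "maximal S (\<lambda>T. T \<subseteq> set (cols A) \<and> lin_indpt T)"
    using maximal_exists[of "(\<lambda>T. T \<subseteq> set (cols A) \<and> lin_indpt T)" "card (set (cols A))" "{}"]
    by (meson List.finite_set card_mono empty_iff empty_subsetI finite_lin_indpt2 rev_finite_subset)
  then have "S \<subseteq> set (cols A)" "lin_indpt S" by (auto simp: maximal_def)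
  moreover have "set (cols A) \<subseteq> carrier_vec n"
    using assms cols_dim by blast
  ultimately have "card S \<le> dim"
    by (intro li_le_dim(2)) (auto simp: fin_dim)
  then show ?thesis
    using rank_card_indpt[OF assms S] dim_is_n by simp
qed

lemma observability_matrix_carrier:
  assumes "A \<in> carrier_mat n n" "C \<in> carrier_mat 1 n"
  shows "observability_matrix A C l \<in> carrier_mat l n"
  using assms by (auto simp: observability_matrix_def vstack_def)

text \<open>An observability matrix with \<open>l\<close> rows has rank at most \<open>l\<close>, so fewer than \<open>n\<close> rows cannot suffice, while
\<open>n\<close> rows do by observability.\<close>

lemma observability_index_single_output:
  assumes "0 < n" "A \<in> carrier_mat n n" "C \<in> carrier_mat 1 n" "observable A C"
  shows "observability_index A C = n"
  unfolding observability_index_def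
proof (rule Least_equality)
  show "0 < n \<and> full_col_rank (observability_matrix A C n)"
    using assms by (simp add: observable_def)
  fix l assume l: "0 < l \<and> full_col_rank (observability_matrix A C l)"
  have O: "observability_matrix A C l \<in> carrier_mat l n"
    using assms by (intro observability_matrix_carrier)
  show "n \<le> l"
    using l vec_space.rank_le_nr[OF O] O by (auto simp: full_col_rank_def)
qed

lemma controllable_imp_inputs:
  assumes "0 < n" "A \<in> carrier_mat n n" "B \<in> carrier_mat n m" "controllable A B"
  shows "0 < m"
proof -
  have "dim_row (controllability_matrix A B) \<le> dim_col (controllability_matrix A B)"
    using assms(4) unfolding controllable_def by (rule full_row_rank_dims)
  then have "n \<le> n * m"
    using assms by (simp add: controllability_matrix_def hstack_def)
  then show ?thesis using assms(1) by (cases m) auto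
qed

text \<open>Page excitation of order \<open>n + 1\<close> provides \<open>(n + 1) * L * m\<close> linearly independent rows, hence as many
columns.  Since \<open>n\<close> and \<open>m\<close> are positive and \<open>n + 1 \<le> L\<close>, this is at least \<open>L * m + L\<close> and so covers the
\<open>L * m + n + 1\<close> rows of the data matrix for \<open>n + 1\<close>.\<close>

lemma page_exciting_wide:
  assumes "page_exciting m L T (n + 1) u" "0 < n" "0 < m" "n + 1 \<le> L"
  shows "L * m + (n + 1) \<le> T div L"
proof -
  have "(n + 1) * (L * m) \<le> (T - n * L) div L"
    using full_row_rank_dims[OF assms(1)[unfolded page_exciting_def]] by (simp add: vstack_def)
  also have "\<dots> \<le> T div L" by (intro div_le_mono) simp
  finally have "(n + 1) * (L * m) \<le> T div L" .
  moreover have "2 * (L * m) \<le> (n + 1) * (L * m)"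
    using assms(2) by (intro mult_le_mono1) simp
  moreover have "L \<le> L * m" using assms(3) by simp
  ultimately show ?thesis using assms(4) by linarith
qed

text \<open>Padding \<open>F\<close> with a zero column makes it square and singular.\<close>

lemma left_kernel_of_tall_matrix:
  fixes F :: "nat \<Rightarrow> nat \<Rightarrow> real"
  shows "\<exists>c. (\<exists>i<n + 1. c i \<noteq> 0) \<and> (\<forall>j<n. (\<Sum>i<n + 1. c i * F i j) = 0)"
proof -
  define P where "P = mat (n + 1) (n + 1) (\<lambda>(i, j). if j < n then F i j else 0)"
  define K where "K = transpose_mat P"
  have P: "P \<in> carrier_mat (n + 1) (n + 1)" by (simp add: P_def)
  then have K: "K \<in> carrier_mat (n + 1) (n + 1)" by (simp add: K_def)
  have "P *\<^sub>v unit_vec (n + 1) n = 0\<^sub>v (n + 1)"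
    by (intro eq_vecI) (auto simp: P_def)
  moreover have "unit_vec (n + 1) n \<noteq> (0\<^sub>v (n + 1) :: real vec)"
    by (metis index_unit_vec(1) index_zero_vec(1) less_add_one zero_neq_one)
  ultimately have "det P = 0"
    using det_0_iff_vec_prod_zero[OF P] unit_vec_carrier by blast
  then have "det K = 0"
    using det_transpose[OF P] by (simp add: K_def)
  then obtain v where v: "v \<in> carrier_vec (n + 1)" "v \<noteq> 0\<^sub>v (n + 1)" "K *\<^sub>v v = 0\<^sub>v (n + 1)"
    using det_0_iff_vec_prod_zero[OF K] by blast
  have "\<exists>i<n + 1. v $ i \<noteq> 0"
    using v(1,2) by (metis carrier_vecD eq_vecI index_zero_vec(1) index_zero_vec(2))
  moreover have "(\<Sum>i<n + 1. v $ i * F i j) = 0" if "j < n" for j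
  proof -
    have "(K *\<^sub>v v) $ j = (\<Sum>i<n + 1. v $ i * F i j)"
      using that v(1) by (simp add: K_def P_def scalar_prod_def lessThan_atLeast0 mult.commute)
    then show ?thesis using that v(3) by simp
  qed
  ultimately show ?thesis by blast
qed

section \<open>Eliminating the state from consecutive outputs\<close>

lemma trajectory_state_carrier:
  assumes "A \<in> carrier_mat n n" "B \<in> carrier_mat n m" "x 1 \<in> carrier_vec n"
    and "trajectory A B C D T u x y" "t \<in> {1..T + 1}"
  shows "x t \<in> carrier_vec n"
proof (cases "t = 1")
  case False
  then obtain s where "t = Suc s" "s \<in> {1..T}"
    using assms(5) by (cases t) auto
  then have "x t = A *\<^sub>v x s + B *\<^sub>v u s"
    using assms(4) by (simp add: trajectory_def)
  then show ?thesis using assms(1,2) by (intro carrier_vecI) simp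
qed (use assms(3) in simp)

lemma trajectory_shift:
  assumes "trajectory A B C D T u x y" "t + k \<le> T"
  shows "trajectory A B C D k (\<lambda>s. u (t + s)) (\<lambda>s. x (t + s)) (\<lambda>s. y (t + s))"
  using assms by (auto simp: trajectory_def)

text \<open>The inputs in a window are flattened as in a Page matrix column: entry \<open>r\<close> is component \<open>r mod m\<close> of the
input \<open>r div m\<close> steps after the start.\<close>

lemma sum_append_block:
  fixes w :: "nat \<Rightarrow> real"
  assumes "b \<in> carrier_vec m" "u (1 + i) \<in> carrier_vec m"
  shows "(\<Sum>r<Suc i * m. (if r < i * m then w r else b $ (r - i * m)) * u (1 + r div m) $ (r mod m))
    = (\<Sum>r<i * m. w r * u (1 + r div m) $ (r mod m)) + b \<bullet> u (1 + i)"
proof -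
  have "Suc i * m = i * m + m" by simp
  moreover have "(i * m + r) div m = i" "(i * m + r) mod m = r" if "r < m" for r
    using that by auto
  ultimately show ?thesis
    using assms by (simp only: sum_lessThan_add) (simp add: scalar_prod_def lessThan_atLeast0)
qed

text \<open>The coefficients \<open>\<rho>\<close> and \<open>w\<close> are chosen before the trajectory: it is this uniformity that later gives one
row combination for all columns of the data matrix.  One step back in time turns the functional \<open>a\<close>
of the state into \<open>A\<^sup>T a\<close> and appends the block \<open>B\<^sup>T a\<close> to the input coefficients.\<close>

lemma state_functional_from_window:
  assumes A: "A \<in> carrier_mat n n" and B: "B \<in> carrier_mat n m" and a: "a \<in> carrier_vec n"
  shows "\<exists>\<rho> w. \<forall>u x y. trajectory A B C D i u x y \<longrightarrow> x 1 \<in> carrier_vec n \<longrightarrow>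
    a \<bullet> x (1 + i) = (\<Sum>l<n. \<rho> l * x 1 $ l) + (\<Sum>r<i * m. w r * u (1 + r div m) $ (r mod m))"
  using a
proof (induction i arbitrary: a)
  case 0
  then show ?case
    by (intro exI[of _ "\<lambda>l. a $ l"] exI[of _ "\<lambda>_. 0"])
      (auto simp: scalar_prod_def lessThan_atLeast0)
next
  case (Suc i)
  define b where "b = transpose_mat B *\<^sub>v a"
  have b: "b \<in> carrier_vec m" using B by (intro carrier_vecI) (simp add: b_def)
  have "transpose_mat A *\<^sub>v a \<in> carrier_vec n"
    using A by (intro carrier_vecI) simp
  from Suc.IH[OF this] obtain \<rho> w where IH: "\<And>u x y. trajectory A B C D i u x y \<Longrightarrow>
    x 1 \<in> carrier_vec n \<Longrightarrow> (transpose_mat A *\<^sub>v a) \<bullet> x (1 + i)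
      = (\<Sum>l<n. \<rho> l * x 1 $ l) + (\<Sum>r<i * m. w r * u (1 + r div m) $ (r mod m))"
    by blast
  have "a \<bullet> x (1 + Suc i) = (\<Sum>l<n. \<rho> l * x 1 $ l)
      + (\<Sum>r<Suc i * m. (if r < i * m then w r else b $ (r - i * m)) * u (1 + r div m) $ (r mod m))"
    if tr: "trajectory A B C D (Suc i) u x y" and x1: "x 1 \<in> carrier_vec n" for u x y
  proof -
    have tri: "trajectory A B C D i u x y"
      using tr by (auto simp: trajectory_def)
    have ui: "u (1 + i) \<in> carrier_vec m"
      and step: "x (1 + Suc i) = A *\<^sub>v x (1 + i) + B *\<^sub>v u (1 + i)"
      using tr B by (auto simp: trajectory_def)
    have xi: "x (1 + i) \<in> carrier_vec n"
      by (rule trajectory_state_carrier[OF A B x1 tri]) simp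
    have "a \<bullet> x (1 + Suc i) = a \<bullet> (A *\<^sub>v x (1 + i)) + a \<bullet> (B *\<^sub>v u (1 + i))"
      unfolding step using A B xi ui Suc.prems by (intro scalar_prod_add_distrib[of _ n]) auto
    also have "\<dots> = (transpose_mat A *\<^sub>v a) \<bullet> x (1 + i) + b \<bullet> u (1 + i)"
      unfolding b_def
      using transpose_vec_mult_scalar[OF A xi Suc.prems] transpose_vec_mult_scalar[OF B ui Suc.prems]
      by simp
    finally show ?thesis
      unfolding IH[OF tri x1] sum_append_block[of b m u i, OF b ui] by simp
  qed
  then show ?case
    by (intro exI[of _ \<rho>] exI[of _ "\<lambda>r. if r < i * m then w r else b $ (r - i * m)"]) simp
qed

lemma output_from_window:
  assumes A: "A \<in> carrier_mat n n" and B: "B \<in> carrier_mat n m"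
    and C: "C \<in> carrier_mat 1 n" and D: "D \<in> carrier_mat 1 m"
  shows "\<exists>\<rho> w. \<forall>u x y. trajectory A B C D (Suc i) u x y \<longrightarrow> x 1 \<in> carrier_vec n \<longrightarrow>
    y (1 + i) $ 0 = (\<Sum>l<n. \<rho> l * x 1 $ l) + (\<Sum>r<Suc i * m. w r * u (1 + r div m) $ (r mod m))"
proof -
  have d: "row D 0 \<in> carrier_vec m" using D by auto
  have "row C 0 \<in> carrier_vec n" using C by auto
  from state_functional_from_window[OF A B this, of C D i]
  obtain \<rho> w where *: "\<And>u x y. trajectory A B C D i u x y \<Longrightarrow> x 1 \<in> carrier_vec n \<Longrightarrow>
    row C 0 \<bullet> x (1 + i)
      = (\<Sum>l<n. \<rho> l * x 1 $ l) + (\<Sum>r<i * m. w r * u (1 + r div m) $ (r mod m))"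
    by blast
  have "y (1 + i) $ 0 = (\<Sum>l<n. \<rho> l * x 1 $ l)
      + (\<Sum>r<Suc i * m. (if r < i * m then w r else row D 0 $ (r - i * m)) * u (1 + r div m) $ (r mod m))"
    if tr: "trajectory A B C D (Suc i) u x y" and x1: "x 1 \<in> carrier_vec n" for u x y
  proof -
    have tri: "trajectory A B C D i u x y"
      using tr by (auto simp: trajectory_def)
    have ui: "u (1 + i) \<in> carrier_vec m"
      and out: "y (1 + i) = C *\<^sub>v x (1 + i) + D *\<^sub>v u (1 + i)"
      using tr B by (auto simp: trajectory_def)
    have "y (1 + i) $ 0 = row C 0 \<bullet> x (1 + i) + row D 0 \<bullet> u (1 + i)"
      unfolding out using C D by simp
    then show ?thesis
      unfolding *[OF tri x1] sum_append_block[of "row D 0" m u i, OF d ui] by simp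
  qed
  then show ?thesis
    by (intro exI[of _ \<rho>] exI[of _ "\<lambda>r. if r < i * m then w r else row D 0 $ (r - i * m)"]) simp
qed

text \<open>The \<open>n + 1\<close> state coefficients of the outputs lie in an \<open>n\<close>-dimensional space; the combination \<open>c\<close> that
makes them cancel leaves only inputs from the same window.\<close>

lemma outputs_dependent_modulo_inputs:
  assumes A: "A \<in> carrier_mat n n" and B: "B \<in> carrier_mat n m"
    and C: "C \<in> carrier_mat 1 n" and D: "D \<in> carrier_mat 1 m"
  shows "\<exists>c w. (\<exists>i<n + 1. c i \<noteq> 0) \<and>
    (\<forall>u x y. trajectory A B C D (n + 1) u x y \<longrightarrow> x 1 \<in> carrier_vec n \<longrightarrow>
      (\<Sum>i<n + 1. c i * y (1 + i) $ 0) = (\<Sum>r<(n + 1) * m. w r * u (1 + r div m) $ (r mod m)))"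
proof -
  define Q where "Q = (\<lambda>i \<rho> w. \<forall>u x y. trajectory A B C D (Suc i) u x y \<longrightarrow> x 1 \<in> carrier_vec n \<longrightarrow>
    y (1 + i) $ 0 = (\<Sum>l<n. \<rho> l * x 1 $ l) + (\<Sum>r<Suc i * m. w r * u (1 + r div m) $ (r mod m)))"
  have "\<forall>i. \<exists>\<rho> w. Q i \<rho> w"
    unfolding Q_def using output_from_window[OF assms] by (rule allI)
  then obtain \<rho> w where Q: "\<And>i. Q i (\<rho> i) (w i)" by metis
  obtain c where c: "\<exists>i<n + 1. c i \<noteq> 0" and ker: "\<And>l. l < n \<Longrightarrow> (\<Sum>i<n + 1. c i * \<rho> i l) = 0"
    using left_kernel_of_tall_matrix[of n \<rho>] by blast
  \<comment> \<open>The output at offset \<open>i\<close> involves only the first \<open>i + 1\<close> input blocks; zero padding brings all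
    input coefficients to the common length \<open>(n + 1) * m\<close>.\<close>
  define W where "W = (\<lambda>r. \<Sum>i<n + 1. c i * (if r < Suc i * m then w i r else 0))"
  have "(\<Sum>i<n + 1. c i * y (1 + i) $ 0) = (\<Sum>r<(n + 1) * m. W r * u (1 + r div m) $ (r mod m))"
    if tr: "trajectory A B C D (n + 1) u x y" and x1: "x 1 \<in> carrier_vec n" for u x y
  proof -
    define U where "U = (\<lambda>r. u (1 + r div m) $ (r mod m))"
    have y: "y (1 + i) $ 0 = (\<Sum>l<n. \<rho> i l * x 1 $ l)
        + (\<Sum>r<(n + 1) * m. (if r < Suc i * m then w i r else 0) * U r)" if i: "i < n + 1" for i
    proof -
      have "trajectory A B C D (Suc i) u x y"
        using tr i by (auto simp: trajectory_def)
      moreover have "(\<Sum>r<(n + 1) * m. (if r < Suc i * m then w i r else 0) * U r)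
          = (\<Sum>r<Suc i * m. w i r * U r)"
      proof (rule sum.mono_neutral_cong_right)
        have "Suc i * m \<le> (n + 1) * m" using i by (intro mult_le_mono1) simp
        then show "{..<Suc i * m} \<subseteq> {..<(n + 1) * m}" by auto
      qed auto
      ultimately show ?thesis using Q[of i] x1 unfolding Q_def U_def by simp
    qed
    have "(\<Sum>i<n + 1. c i * y (1 + i) $ 0)
        = (\<Sum>i<n + 1. c i * ((\<Sum>l<n. \<rho> i l * x 1 $ l)
            + (\<Sum>r<(n + 1) * m. (if r < Suc i * m then w i r else 0) * U r)))"
      by (intro sum.cong refl) (simp only: lessThan_iff y)
    also have "\<dots> = (\<Sum>i<n + 1. \<Sum>l<n. c i * \<rho> i l * x 1 $ l)
        + (\<Sum>i<n + 1. \<Sum>r<(n + 1) * m. c i * (if r < Suc i * m then w i r else 0) * U r)"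
      by (simp only: distrib_left sum.distrib sum_distrib_left mult.assoc)
    also have "(\<Sum>i<n + 1. \<Sum>l<n. c i * \<rho> i l * x 1 $ l) = (\<Sum>l<n. (\<Sum>i<n + 1. c i * \<rho> i l) * x 1 $ l)"
      by (subst sum.swap) (simp only: sum_distrib_right)
    also have "\<dots> = 0"
      using ker by (intro sum.neutral ballI) (simp only: lessThan_iff mult_zero_left)
    also have "(\<Sum>i<n + 1. \<Sum>r<(n + 1) * m. c i * (if r < Suc i * m then w i r else 0) * U r)
        = (\<Sum>r<(n + 1) * m. W r * U r)"
      unfolding W_def by (subst sum.swap) (simp only: sum_distrib_right)
    finally show ?thesis by (simp add: U_def)
  qed
  with c show ?thesis by (intro exI[of _ c] exI[of _ W]) simp
qed

section \<open>Correctness of the order search\<close>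

theorem proposition12:
  fixes A B C D :: "real mat"
    and n m L T :: nat
    and \<delta> :: real
    and M :: "'w measure"
    and Q :: "real vec measure"
    and u x y yh :: "'w \<Rightarrow> nat \<Rightarrow> real vec"
  assumes "0 < n"
    and "A \<in> carrier_mat n n" and "B \<in> carrier_mat n m"
    and "C \<in> carrier_mat 1 n" and "D \<in> carrier_mat 1 m"
    and "controllable A B" and "observable A C"
    and "observability_index A C < L"
    and "4 * L^2 + L \<le> T"
    and "0 < \<delta>"
    and "prob_space M"
    and "prob_space Q" and "sets Q = sets (borel_vec (L * m))"
    and "null_on_proper_subspaces (L * m) Q"
    and "prob_space.indep_vars M (\<lambda>_. borel_vec (L * m))
           (\<lambda>i \<omega>. col_seq m (u \<omega>) (i * L + 1) (i * L + L)) {0..4 * L}"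
    and "\<forall>i\<in>{0..4 * L}.
           distr M (borel_vec (L * m)) (\<lambda>\<omega>. col_seq m (u \<omega>) (i * L + 1) (i * L + L)) = Q"
    and "\<forall>\<omega>\<in>space M. x \<omega> 1 = 0\<^sub>v n \<and> trajectory A B C D T (u \<omega>) (x \<omega>) (y \<omega>)"
    and "\<forall>\<omega>\<in>space M. \<forall>t\<in>{1..T}. yh \<omega> t \<in> carrier_vec 1"
  shows "AE \<omega> in M.
           page_exciting m L T (n + 1) (u \<omega>) \<longrightarrow>
           noise_bounded 1 L T \<delta> (y \<omega>) (yh \<omega>) \<longrightarrow>
           \<delta> < sigma_min (data_matrix m 1 L T (u \<omega>) (yh \<omega>) (observability_index A C))
                 / (2 * real (T div L)) \<longrightarrow>
           order_search m 1 L T \<delta> (u \<omega>) (yh \<omega>) = Some (observability_index A C)"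
proof (rule AE_I2, intro impI)
  fix \<omega> assume \<omega>: "\<omega> \<in> space M"
    and exciting: "page_exciting m L T (n + 1) (u \<omega>)"
    and noise: "noise_bounded 1 L T \<delta> (y \<omega>) (yh \<omega>)"
    and margin: "\<delta> < sigma_min (data_matrix m 1 L T (u \<omega>) (yh \<omega>) (observability_index A C))
                 / (2 * real (T div L))"
  note A = assms(2) and B = assms(3) and C = assms(4) and D = assms(5)
  define \<sigma> where "\<sigma> = (\<lambda>k. sigma_min (data_matrix m 1 L T (u \<omega>) (yh \<omega>) k))"
  have index: "observability_index A C = n"
    using assms(1) A C assms(7) by (rule observability_index_single_output)
  then have "n + 1 \<le> L" using assms(8) by simp
  have "0 < m" using assms(1) A B assms(6) by (rule controllable_imp_inputs)
  have wide: "L * m + (n + 1) \<le> T div L"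
    using exciting assms(1) \<open>0 < m\<close> \<open>n + 1 \<le> L\<close> by (rule page_exciting_wide)
  have x1: "x \<omega> 1 = 0\<^sub>v n" and traj: "trajectory A B C D T (u \<omega>) (x \<omega>) (y \<omega>)"
    using assms(17) \<omega> by auto

  have below: "real (T div L) * \<delta> < \<sigma> k" if "1 \<le> k" "k \<le> n" for k
  proof -
    have l: "0 < real (T div L)" using wide by simp
    have "real (T div L) * \<delta> \<le> 2 * real (T div L) * \<delta>"
      using l assms(10) by simp
    also have "\<dots> < \<sigma> n"
      using margin l by (simp add: \<sigma>_def index field_simps)
    also have "\<sigma> n \<le> \<sigma> k"
      unfolding \<sigma>_def using that wide \<open>n + 1 \<le> L\<close>
      by (intro sigma_min_data_matrix_antimono) auto
    finally show ?thesis .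
  qed

  \<comment> \<open>Column \<open>j\<close> of a Page matrix is the window starting at time \<open>j * L + 1\<close>, so one dependence serves
    all columns.\<close>
  obtain c w where c: "\<exists>i<n + 1. c i \<noteq> 0" and dep: "\<forall>u x y. trajectory A B C D (n + 1) u x y \<longrightarrow>
      x 1 \<in> carrier_vec n \<longrightarrow>
      (\<Sum>i<n + 1. c i * y (1 + i) $ 0) = (\<Sum>r<(n + 1) * m. w r * u (1 + r div m) $ (r mod m))"
    using outputs_dependent_modulo_inputs[OF A B C D]
    by - (erule exE, erule exE, erule conjE, rule that)
  have rel: "(\<Sum>i<n + 1. c i * page_matrix 1 L (y \<omega>) 1 T $$ (i, j))
      = (\<Sum>r<(n + 1) * m. w r * page_matrix m L (u \<omega>) 1 T $$ (r, j))" if j: "j < T div L" for j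
  proof -
    have "(j + 1) * L \<le> T div L * L" using j by (intro mult_le_mono1) simp
    also have "\<dots> \<le> T" by simp
    finally have jL: "j * L + (n + 1) \<le> T" using \<open>n + 1 \<le> L\<close> by simp
    have "x \<omega> (j * L + 1) \<in> carrier_vec n"
      by (rule trajectory_state_carrier[OF A B _ traj]) (use x1 jL in auto)
    with dep trajectory_shift[OF traj jL]
    have "(\<Sum>i<n + 1. c i * y \<omega> (j * L + (1 + i)) $ 0)
        = (\<Sum>r<(n + 1) * m. w r * u \<omega> (j * L + (1 + r div m)) $ (r mod m))"
      by (elim allE[of _ "\<lambda>s. u \<omega> (j * L + s)"] allE[of _ "\<lambda>s. x \<omega> (j * L + s)"]
          allE[of _ "\<lambda>s. y \<omega> (j * L + s)"]) simp
    moreover have "page_matrix 1 L (y \<omega>) 1 T $$ (i, j) = y \<omega> (j * L + (1 + i)) $ 0"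
      if "i < n + 1" for i
      using that \<open>n + 1 \<le> L\<close> j by (subst page_matrix_index) (auto simp: ac_simps)
    moreover have "page_matrix m L (u \<omega>) 1 T $$ (r, j) = u \<omega> (j * L + (1 + r div m)) $ (r mod m)"
      if r: "r < (n + 1) * m" for r
    proof -
      have "r < L * m" using r mult_le_mono1[OF \<open>n + 1 \<le> L\<close>, of m] by linarith
      then show ?thesis using j by (subst page_matrix_index) (auto simp: ac_simps)
    qed
    ultimately show ?thesis by simp
  qed
  have above: "\<sigma> (n + 1) \<le> real (T div L) * \<delta>"
    unfolding \<sigma>_def using \<open>n + 1 \<le> L\<close> wide noise c rel less_imp_le[OF assms(10)]
    by (rule sigma_min_data_matrix_le)

  \<comment> \<open>The list starts at \<open>1\<close>, so \<open>n + 1\<close> is its entry number \<open>n\<close>.\<close>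
  have "find (\<lambda>k. \<sigma> k \<le> real (T div L) * \<delta>) [1..<L + 1] = Some (n + 1)"
    unfolding find_Some_iff using above below \<open>n + 1 \<le> L\<close>
    by (intro exI[of _ n]) (auto simp: nth_upt not_le simp del: upt_Suc)
  then show "order_search m 1 L T \<delta> (u \<omega>) (yh \<omega>) = Some (observability_index A C)"
    unfolding order_search_def index \<sigma>_def by simp
qed

end
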